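(* Let $0<p<q<\infty$ and let $X,Y$ be nonnegative random variables such that $X$ is both $\{p,q\}$-min-hypercontractive and $\{p,q\}$-max-hypercontractive. If there exists a constant $B$ such that $\|m_n(Y)\|_q\le B\|m_n(X)\|_q$ and $\|M_n(Y)\|_q\le B\|M_n(X)\|_q$ for all $n\ge 1$, then there exists a constant $D$ such that $P(Y\le t)\ge P(DX\le t)$ for all $t\in[0,\infty)$.
   Context: $\|W\|_r=(E|W|^r)^{1/r}$. For a nonnegative random variable $W$, $m_n(W)$ and $M_n(W)$ denote the minimum and the maximum of $n$ i.i.d. copies of $W$. A nonnegative random variable $W$ with $EW^q<\infty$ is $\{p,q\}$-min-hypercontractive if there is a constant $C$ with $\|m_n(W)\|_q\le C\|m_n(W)\|_p$ for all $n\ge1$, and $\{p,q\}$-max-hypercontractive if there is a constant $C$ with $\|M_n(W)\|_q\le C\|M_n(W)\|_p$ for all $n\ge 1$. *)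

theory Defs
  imports "HOL-Probability.Probability"
begin

text \<open>\<open>(E |W|^r)^(1/r)\<close> for \<open>r > 0\<close>, as an extended nonnegative real: it is \<open>\<infinity>\<close> if the
  \<open>r\<close>-th absolute moment is infinite (the Bochner integral would give \<open>0\<close> there).\<close>

definition moment_norm :: "'a measure \<Rightarrow> real \<Rightarrow> ('a \<Rightarrow> real) \<Rightarrow> ennreal" where
  "moment_norm M r W =
     (let I = (\<integral>\<^sup>+ \<omega>. ennreal (\<bar>W \<omega>\<bar> powr r) \<partial>M)
      in if I = \<infinity> then \<infinity> else ennreal (enn2real I powr (1 / r)))"

text \<open>The \<open>n\<close> i.i.d. copies of a random variable \<open>W\<close> on \<open>M\<close> are realised as \<open>\<omega> \<mapsto> W (\<omega> i)\<close>,
  \<open>i < n\<close>, on the \<open>n\<close>-fold product of \<open>M\<close>; the law of their minimum and maximum does not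
  depend on the realisation. \<open>Min\<close> and \<open>Max\<close> are meaningful only for \<open>n \<ge> 1\<close>.\<close>

definition iid_space :: "'a measure \<Rightarrow> nat \<Rightarrow> (nat \<Rightarrow> 'a) measure" where
  "iid_space M n = (\<Pi>\<^sub>M i\<in>{..<n}. M)"

definition iid_min :: "nat \<Rightarrow> ('a \<Rightarrow> real) \<Rightarrow> (nat \<Rightarrow> 'a) \<Rightarrow> real" where
  "iid_min n W \<omega> = (MIN i\<in>{..<n}. W (\<omega> i))"

definition iid_max :: "nat \<Rightarrow> ('a \<Rightarrow> real) \<Rightarrow> (nat \<Rightarrow> 'a) \<Rightarrow> real" where
  "iid_max n W \<omega> = (MAX i\<in>{..<n}. W (\<omega> i))"

abbreviation min_norm :: "'a measure \<Rightarrow> real \<Rightarrow> nat \<Rightarrow> ('a \<Rightarrow> real) \<Rightarrow> ennreal" where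
  "min_norm M r n W \<equiv> moment_norm (iid_space M n) r (iid_min n W)"

abbreviation max_norm :: "'a measure \<Rightarrow> real \<Rightarrow> nat \<Rightarrow> ('a \<Rightarrow> real) \<Rightarrow> ennreal" where
  "max_norm M r n W \<equiv> moment_norm (iid_space M n) r (iid_max n W)"

definition nonneg_rv :: "'a measure \<Rightarrow> ('a \<Rightarrow> real) \<Rightarrow> bool" where
  "nonneg_rv M W \<longleftrightarrow> W \<in> borel_measurable M \<and> (\<forall>\<omega>\<in>space M. 0 \<le> W \<omega>)"

definition min_hypercontractive :: "'a measure \<Rightarrow> real \<Rightarrow> real \<Rightarrow> ('a \<Rightarrow> real) \<Rightarrow> bool" where
  "min_hypercontractive M p q W \<longleftrightarrow>
     nonneg_rv M W \<and> (\<integral>\<^sup>+ \<omega>. ennreal (W \<omega> powr q) \<partial>M) < \<infinity> \<and>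
     (\<exists>C\<ge>0. \<forall>n\<ge>1. min_norm M q n W \<le> ennreal C * min_norm M p n W)"

definition max_hypercontractive :: "'a measure \<Rightarrow> real \<Rightarrow> real \<Rightarrow> ('a \<Rightarrow> real) \<Rightarrow> bool" where
  "max_hypercontractive M p q W \<longleftrightarrow>
     nonneg_rv M W \<and> (\<integral>\<^sup>+ \<omega>. ennreal (W \<omega> powr q) \<partial>M) < \<infinity> \<and>
     (\<exists>C\<ge>0. \<forall>n\<ge>1. max_norm M q n W \<le> ennreal C * max_norm M p n W)"

end

theory Submission
  imports Defs
begin

text \<open>
Write \<open>F t = P(X > t)\<close> and \<open>G t = P(Y > t)\<close>; a constant \<open>D\<close> with \<open>G t \<le> F (t / D)\<close> for all \<open>t \<ge> 0\<close> is
wanted. The idea is that the norms \<open>a\<^sub>n = \<parallel>m\<^sub>n(X)\<parallel>\<^sub>p\<close> and \<open>b\<^sub>n = \<parallel>M\<^sub>n(X)\<parallel>\<^sub>p\<close> act as approximate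
quantiles of \<open>X\<close>, and bound the corresponding quantiles of \<open>Y\<close> up to a constant factor.

By hypercontractivity, a Paley--Zygmund argument (\<open>hypercontractive_tail_lower\<close>) gives constants
\<open>l, c > 0\<close> with \<open>P(m\<^sub>n(X) > l * a\<^sub>n) \<ge> c\<close> for all \<open>n\<close>, that is, \<open>F (l * a\<^sub>n) ^ n \<ge> c\<close>. In the other
direction \<open>\<parallel>m\<^sub>n(Y)\<parallel>\<^sub>q \<le> B * C * a\<^sub>n\<close>, and Markov's inequality (\<open>dominated_tail_upper\<close>) makes
\<open>G (s * a\<^sub>n) ^ n\<close> as small as desired, uniformly in \<open>n\<close>, once \<open>s\<close> is large; the bound \<open>c\<^sup>2 / 2\<close> is enough. The same
holds for the maxima, with \<open>1 - (1 - F (l * b\<^sub>n)) ^ n\<close>, which is of order \<open>n * F (l * b\<^sub>n)\<close> when that is small, in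
place of \<open>F (l * a\<^sub>n) ^ n\<close>. Lemma \<open>comparable_tails\<close> collects these bounds.

It remains to pass from the points \<open>s * a\<^sub>n\<close> and \<open>s * b\<^sub>n\<close> to arbitrary \<open>t\<close>
(\<open>tail_comparison_of_sequences\<close>). Since \<open>a\<^sub>1 = b\<^sub>1\<close>, the minima cover the values \<open>t < s * a\<^sub>1\<close> and the
maxima those with \<open>t \<ge> s * a\<^sub>1\<close>. If \<open>t\<close> lies between neighbouring grid points, monotonicity of \<open>F\<close> and \<open>G\<close> gives
the claim. If \<open>t\<close> lies below all \<open>s * a\<^sub>n\<close> then \<open>F (l * t / s) = 1\<close>, and if it lies above all \<open>s * b\<^sub>n\<close> then
\<open>G t = 0\<close>. So \<open>D = s / l\<close> works. The only case in which the scales \<open>a\<^sub>n\<close>, \<open>b\<^sub>n\<close> degenerate is \<open>X = 0\<close>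
almost surely, where also \<open>Y = 0\<close> almost surely.
\<close>

section \<open>Interpolating between consecutive sample sizes\<close>

lemma pow_bounded_below_imp_one:
  fixes x c :: real
  assumes "0 \<le> x" "x \<le> 1" "0 < c" and low: "\<And>n. n \<ge> 1 \<Longrightarrow> c \<le> x ^ n"
  shows "x = 1"
proof (rule ccontr)
  assume "x \<noteq> 1"
  with assms have "x < 1" by simp
  then obtain n where n: "x ^ n < c" using real_arch_pow_inv[of c x] assms by blast
  have "x ^ Suc n \<le> x ^ n" using assms by (simp add: mult_left_le_one_le)
  with n low[of "Suc n"] show False by simp
qed

lemma union_prob_lower:
  fixes x :: real
  assumes "0 \<le> x" "x \<le> 1"
  shows "1 - (1 - x) ^ n \<le> n * x"
  using Bernoulli_inequality[of "- x" n] assms by (simp add: algebra_simps)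

text \<open>A converse to the union bound: since \<open>(1 - x) ^ n * (1 + x) ^ n \<le> 1\<close>, Bernoulli's inequality
for \<open>1 + x\<close> bounds \<open>(1 - x) ^ n\<close> from above by \<open>1 / (1 + n * x)\<close>.\<close>
lemma union_prob_small_imp:
  fixes x d :: real
  assumes "0 \<le> x" "x \<le> 1" "d \<le> 1/2" and small: "1 - (1 - x) ^ n \<le> d"
  shows "n * x \<le> 2 * d"
proof -
  have "(1 - d) * (1 + n * x) \<le> (1 - x) ^ n * (1 + x) ^ n"
    using Bernoulli_inequality[of x n] assms by (intro mult_mono) auto
  also have "\<dots> = ((1 - x) * (1 + x)) ^ n" by (simp add: power_mult_distrib)
  also have "\<dots> \<le> 1"
    using assms by (intro power_le_one) (auto simp: algebra_simps mult_le_one)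
  finally have *: "(1 - d) * (1 + n * x) \<le> 1" .
  have "1/2 * (n * x) \<le> (1 - d) * (n * x)"
    using assms by (intro mult_right_mono) auto
  with * show ?thesis by (simp add: algebra_simps)
qed

text \<open>Here \<open>F\<close> and \<open>G\<close> are the tails of \<open>X\<close> and \<open>Y\<close>, and \<open>a n\<close>, \<open>b n\<close> are the scales of the minimum and
the maximum of \<open>n\<close> copies of \<open>X\<close>. A number \<open>t < s * a 1\<close>
that is not below all \<open>s * a n\<close> lies between two consecutive ones, and similarly
\<open>t \<ge> s * a 1 = s * b 1\<close> for the maxima. Monotonicity moves the argument of \<open>G\<close> down to the lower point and
that of \<open>F\<close> up to the upper one, so the sample sizes differ by one; the bound \<open>c\<^sup>2 / 2\<close> for \<open>G\<close>,
smaller than the bound \<open>c\<close> for \<open>F\<close>, pays for this shift.\<close>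
lemma tail_comparison_of_sequences:
  fixes F G :: "real \<Rightarrow> real" and a b :: "nat \<Rightarrow> real" and c l s t :: real
  assumes F: "antimono F" "\<And>t. 0 \<le> F t" "\<And>t. F t \<le> 1"
    and G: "antimono G" "\<And>t. 0 \<le> G t" "\<And>t. G t \<le> 1"
    and c: "0 < c" "c \<le> 1/2" and l: "0 < l" and s: "0 < s" and start: "a 1 = b 1"
    and minF: "\<And>n. n \<ge> 1 \<Longrightarrow> c \<le> F (l * a n) ^ n"
    and minG: "\<And>n. n \<ge> 1 \<Longrightarrow> G (s * a n) ^ n \<le> c\<^sup>2 / 2"
    and maxF: "\<And>n. n \<ge> 1 \<Longrightarrow> c \<le> 1 - (1 - F (l * b n)) ^ n"
    and maxG: "\<And>n. n \<ge> 1 \<Longrightarrow> 1 - (1 - G (s * b n)) ^ n \<le> c\<^sup>2 / 2"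
  shows "G t \<le> F (l * t / s)"
proof -
  have c2: "c\<^sup>2 / 2 \<le> c / 4" "c\<^sup>2 \<le> 1/2"
    using c mult_mono[of c "1/2" c c] mult_mono[of c "1/2" c "1/2"]
    by (auto simp: power2_eq_square)
  have F_ge: "F (l * u) \<le> F (l * t / s)" if "t \<le> s * u" for u
    using that l s by (intro antimonoD[OF F(1)]) (simp add: field_simps)
  have G_le: "G t \<le> G (s * u)" if "s * u \<le> t" for u
    using antimonoD[OF G(1) that] .
  show ?thesis
  proof (cases "t < s * a 1")
    case True
    show ?thesis
    proof (cases "\<exists>n\<ge>1. s * a n \<le> t")
      case False
      \<comment> \<open>All scaled minima norms exceed \<open>t\<close>, so the lower bound \<open>c\<close> holds at this one
        argument for every power.\<close>
      have "c \<le> F (l * t / s) ^ n" if "n \<ge> 1" for n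
      proof -
        have "F (l * a n) ^ n \<le> F (l * t / s) ^ n"
          using False that by (intro power_mono F_ge F) auto
        with minF[OF that] show ?thesis by simp
      qed
      then have "F (l * t / s) = 1" using F c by (intro pow_bounded_below_imp_one) auto
      then show ?thesis using G by simp
    next
      case ex: True
      define n where "n = (LEAST n. n \<ge> 1 \<and> s * a n \<le> t)"
      have n: "n \<ge> 1" "s * a n \<le> t" using LeastI_ex[OF ex] by (auto simp: n_def)
      with True have "n \<noteq> 1" by auto
      with n obtain m where m: "n = Suc m" "m \<ge> 1" by (cases n) auto
      have less: "t < s * a m"
        using not_less_Least[of m "\<lambda>n. n \<ge> 1 \<and> s * a n \<le> t", folded n_def] m by auto
      have "G t ^ n \<le> G (s * a n) ^ n" using G_le[OF n(2)] G by (intro power_mono) auto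
      also have "\<dots> \<le> c\<^sup>2" using minG[OF n(1)] zero_le_power2[of c] by linarith
      \<comment> \<open>Squaring turns the exponent \<open>m\<close> into \<open>2 * m \<ge> Suc m\<close>, which absorbs the shift from
        \<open>m\<close> to \<open>n = Suc m\<close>.\<close>
      also have "\<dots> \<le> (F (l * a m) ^ m)\<^sup>2" using minF[OF m(2)] c by (intro power_mono) auto
      also have "\<dots> = F (l * a m) ^ (m * 2)" by (simp add: power_mult)
      also have "\<dots> \<le> F (l * a m) ^ n" using F m by (intro power_decreasing) auto
      finally have "G t \<le> F (l * a m)" using F G n by (simp add: power_mono_iff)
      also have "\<dots> \<le> F (l * t / s)" using less by (intro F_ge) simp
      finally show ?thesis .
    qed
  next
    case False
    show ?thesis
    proof (cases "\<exists>n\<ge>1. t < s * b n")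
      case none: False
      \<comment> \<open>All scaled maxima norms are at most \<open>t\<close>: the powers of \<open>1 - G t\<close> stay away from \<open>0\<close>, which
        forces \<open>G t = 0\<close>.\<close>
      have "1 / 2 \<le> (1 - G t) ^ n" if "n \<ge> 1" for n
      proof -
        have "(1 - G (s * b n)) ^ n \<le> (1 - G t) ^ n"
          using none that G G_le[of "b n"] by (intro power_mono) auto
        with maxG[OF that] c2 show ?thesis by simp
      qed
      then have "1 - G t = 1" using G by (intro pow_bounded_below_imp_one[of _ "1/2"]) auto
      then show ?thesis using F by simp
    next
      case ex: True
      define n where "n = (LEAST n. n \<ge> 1 \<and> t < s * b n)"
      have n: "n \<ge> 1" "t < s * b n" using LeastI_ex[OF ex] by (auto simp: n_def)
      with False start have "n \<noteq> 1" by auto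
      with n obtain m where m: "n = Suc m" "m \<ge> 1" by (cases n) auto
      have le: "s * b m \<le> t"
        using not_less_Least[of m "\<lambda>n. n \<ge> 1 \<and> t < s * b n", folded n_def] m by auto
      \<comment> \<open>Here the shift costs the factor \<open>Suc m / m \<le> 2\<close>.\<close>
      have "n * G t \<le> (2 * m) * G (s * b m)"
        using G_le[OF le] G m by (intro mult_mono) auto
      also have "\<dots> = 2 * (m * G (s * b m))" by simp
      also have "\<dots> \<le> 2 * (2 * (c\<^sup>2 / 2))"
        using maxG[OF m(2)] G c2 by (intro mult_left_mono union_prob_small_imp) auto
      also have "\<dots> \<le> c" using c2 by simp
      also have "\<dots> \<le> n * F (l * b n)"
        using maxF[OF n(1)] union_prob_lower[of "F (l * b n)" n] F by force
      finally have "G t \<le> F (l * b n)" using n by simp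
      also have "\<dots> \<le> F (l * t / s)" using n by (intro F_ge) simp
      finally show ?thesis .
    qed
  qed
qed

section \<open>Moment norms and tail probabilities\<close>

lemma moment_norm_lt_top_iff:
  "moment_norm P r W < \<top> \<longleftrightarrow> (\<integral>\<^sup>+ \<omega>. ennreal (\<bar>W \<omega>\<bar> powr r) \<partial>P) < \<top>"
  by (simp add: moment_norm_def Let_def less_top)

lemma moment_eq_moment_norm_powr:
  assumes "0 < r" and "moment_norm P r W < \<infinity>"
  shows "(\<integral>\<^sup>+ \<omega>. ennreal (\<bar>W \<omega>\<bar> powr r) \<partial>P) = ennreal (enn2real (moment_norm P r W) powr r)"
proof -
  let ?I = "\<integral>\<^sup>+ \<omega>. ennreal (\<bar>W \<omega>\<bar> powr r) \<partial>P"
  have "?I < \<top>" using assms by (simp add: moment_norm_lt_top_iff)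
  moreover from this have "moment_norm P r W = ennreal (enn2real ?I powr (1 / r))"
    by (simp add: moment_norm_def Let_def)
  ultimately show ?thesis using assms(1) by (simp add: powr_powr)
qed

lemma moment_norm_tail_bound:
  assumes "prob_space P" and [measurable]: "W \<in> borel_measurable P" and "0 < q" "0 < t" "0 \<le> b"
    and le: "moment_norm P q W \<le> ennreal b"
  shows "measure P {\<omega>\<in>space P. t < W \<omega>} \<le> (b / t) powr q"
proof -
  interpret prob_space P by fact
  define A where "A = {\<omega>\<in>space P. t < W \<omega>}"
  have [measurable]: "A \<in> sets P" by (auto simp: A_def)
  have fin: "moment_norm P q W < \<infinity>" using le by (simp add: le_less_trans)
  have "ennreal (t powr q * prob A) = (\<integral>\<^sup>+ \<omega>. ennreal (t powr q) * indicator A \<omega> \<partial>P)"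
    by (simp add: nn_integral_cmult_indicator emeasure_eq_measure ennreal_mult')
  also have "\<dots> \<le> (\<integral>\<^sup>+ \<omega>. ennreal (\<bar>W \<omega>\<bar> powr q) \<partial>P)"
    using assms by (intro nn_integral_mono)
      (auto simp: A_def indicator_def intro!: ennreal_leI powr_mono2)
  also have "\<dots> = ennreal (enn2real (moment_norm P q W) powr q)"
    by (rule moment_eq_moment_norm_powr) fact+
  also have "\<dots> \<le> ennreal (b powr q)"
    using assms by (intro ennreal_leI powr_mono2 enn2real_leI) auto
  finally have "t powr q * prob A \<le> b powr q" by simp
  then show ?thesis using assms by (simp add: A_def powr_divide field_simps)
qed

lemma moment_norm_lt_top_mono:
  assumes "prob_space P" and [measurable]: "W \<in> borel_measurable P" and "0 < p" "p < q"
    and "moment_norm P q W < \<infinity>"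
  shows "moment_norm P p W < \<infinity>"
proof -
  interpret prob_space P by fact
  \<comment> \<open>On a space of total mass one this pointwise bound makes the lower moment finite.\<close>
  have le: "x powr p \<le> 1 + x powr q" if "0 \<le> x" for x :: real
  proof (cases "x \<le> 1")
    case True
    then have "x powr p \<le> 1 powr p" using that assms by (intro powr_mono2) auto
    then show ?thesis using powr_ge_zero[of x q] unfolding powr_one_eq_one by linarith
  next
    case False
    then have "x powr p \<le> x powr q" using assms by (intro powr_mono) auto
    then show ?thesis by linarith
  qed
  have "(\<integral>\<^sup>+ \<omega>. ennreal (\<bar>W \<omega>\<bar> powr p) \<partial>P) \<le> (\<integral>\<^sup>+ \<omega>. 1 + ennreal (\<bar>W \<omega>\<bar> powr q) \<partial>P)"
    using le by (intro nn_integral_mono) (auto simp flip: ennreal_1 ennreal_plus intro!: ennreal_leI)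
  also have "\<dots> = 1 + (\<integral>\<^sup>+ \<omega>. ennreal (\<bar>W \<omega>\<bar> powr q) \<partial>P)"
    by (subst nn_integral_add) (auto simp: emeasure_space_1)
  also have "\<dots> < \<infinity>" using assms(5) by (simp add: moment_norm_lt_top_iff ennreal_add_less_top)
  finally show ?thesis by (simp add: moment_norm_lt_top_iff)
qed

text \<open>The constants of the lower tail bound below. The truncation height \<open>K\<close> is chosen such that
\<open>C powr q * K powr (p - q) \<le> 1 / 4\<close>, and the level \<open>l\<close> such that \<open>l powr p = 1 / 4\<close>. They depend
on \<open>p\<close>, \<open>q\<close> and \<open>C\<close> only, which makes the bound uniform over all sample sizes.\<close>
definition pz_trunc :: "real \<Rightarrow> real \<Rightarrow> real \<Rightarrow> real" where
  "pz_trunc p q C = max 1 ((4 * C powr q) powr (1 / (q - p)))"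

definition pz_level :: "real \<Rightarrow> real" where
  "pz_level p = (1 / 4) powr (1 / p)"

definition pz_prob :: "real \<Rightarrow> real \<Rightarrow> real \<Rightarrow> real" where
  "pz_prob p q C = 1 / (2 * pz_trunc p q C powr p)"

lemma pz_prob_bounds: "0 < p \<Longrightarrow> 0 < pz_prob p q C" "0 < p \<Longrightarrow> pz_prob p q C \<le> 1 / 2"
proof -
  assume p: "0 < p"
  have "1 \<le> pz_trunc p q C powr p"
    using p by (intro ge_one_powr_ge_zero) (auto simp: pz_trunc_def)
  moreover from this have "0 < pz_trunc p q C powr p" by linarith
  ultimately show "0 < pz_prob p q C" "pz_prob p q C \<le> 1 / 2"
    by (simp_all add: pz_prob_def divide_le_eq_1 field_simps)
qed

text \<open>A Paley--Zygmund inequality: a variable whose \<open>q\<close>-norm is comparable to its \<open>p\<close>-norm \<open>a\<close> exceeds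
a fixed multiple of \<open>a\<close> with probability bounded below. Of the \<open>p\<close>-th moment \<open>a powr p\<close>, the
values of \<open>W\<close> up to \<open>l * a\<close> contribute at most a quarter, and those above \<open>K * a\<close>, where
\<open>W powr p \<le> (K * a) powr (p - q) * W powr q\<close>, at most another quarter. The remaining half comes
from values between \<open>l * a\<close> and \<open>K * a\<close>, so the event \<open>l * a < W\<close> must have probability at least
\<open>1 / (2 * K powr p)\<close>.\<close>
lemma hypercontractive_tail_lower:
  fixes P :: "'c measure" and W :: "'c \<Rightarrow> real"
  assumes "prob_space P" and rv: "nonneg_rv P W" and pq: "0 < p" "p < q" and "0 \<le> C"
    and fin: "moment_norm P q W < \<infinity>"
    and hyper: "moment_norm P q W \<le> ennreal C * moment_norm P p W"
    and a: "a = enn2real (moment_norm P p W)" "0 < a"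
  shows "pz_prob p q C \<le> measure P {\<omega>\<in>space P. pz_level p * a < W \<omega>}"
proof -
  interpret prob_space P by fact
  have [measurable]: "W \<in> borel_measurable P" and nonneg: "\<And>\<omega>. \<omega> \<in> space P \<Longrightarrow> 0 \<le> W \<omega>"
    using rv by (auto simp: nonneg_rv_def)
  define b where "b = enn2real (moment_norm P q W)"
  define K where "K = pz_trunc p q C"
  define l where "l = pz_level p"
  define A where "A = {\<omega>\<in>space P. l * a < W \<omega>}"
  have [measurable]: "A \<in> sets P" by (auto simp: A_def)
  have K: "1 \<le> K" by (simp add: K_def pz_trunc_def)
  have l: "0 < l" "l powr p = 1/4" using assms by (auto simp: l_def pz_level_def powr_powr)
  have finp: "moment_norm P p W < \<infinity>" by (rule moment_norm_lt_top_mono[OF _ _ pq fin]) fact+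
  have b0: "0 \<le> b" by (simp add: b_def)
  have "ennreal b \<le> ennreal (C * a)"
    using hyper fin finp assms by (simp add: b_def less_top ennreal_mult)
  then have b: "b \<le> C * a" using assms by simp
  have ptw: "W \<omega> powr p \<le> (l * a) powr p + (K * a) powr p * indicator A \<omega> + (K * a) powr (p - q) * W \<omega> powr q"
    if "\<omega> \<in> space P" for \<omega>
  proof -
    have W: "0 \<le> W \<omega>" using nonneg that .
    consider "W \<omega> \<le> l * a" | "l * a < W \<omega>" "W \<omega> \<le> K * a" | "K * a < W \<omega>" by linarith
    then show ?thesis
    proof cases
      case 1
      then have "W \<omega> powr p \<le> (l * a) powr p" using W assms by (intro powr_mono2) auto
      moreover have "0 \<le> (K * a) powr p * indicator A \<omega>" "0 \<le> (K * a) powr (p - q) * W \<omega> powr q"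
        by auto
      ultimately show ?thesis by linarith
    next
      case 2
      then have "W \<omega> powr p \<le> (K * a) powr p * indicator A \<omega>" 
        using W assms that by (auto simp: A_def intro!: powr_mono2)
      moreover have "0 \<le> (l * a) powr p" "0 \<le> (K * a) powr (p - q) * W \<omega> powr q"
        by auto
      ultimately show ?thesis by linarith
    next
      case 3
      have Ka: "0 < K * a" using K a by simp
      have "W \<omega> powr p = W \<omega> powr (p - q) * W \<omega> powr q" by (simp flip: powr_add)
      also have "\<dots> \<le> (K * a) powr (p - q) * W \<omega> powr q"
        using 3 Ka assms by (intro mult_right_mono powr_mono2') auto
      finally have "W \<omega> powr p \<le> (K * a) powr (p - q) * W \<omega> powr q" .
      moreover have "0 \<le> (l * a) powr p" "0 \<le> (K * a) powr p * indicator A \<omega>"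
        by auto
      ultimately show ?thesis by linarith
    qed
  qed
  have "ennreal (a powr p) = (\<integral>\<^sup>+ \<omega>. ennreal (\<bar>W \<omega>\<bar> powr p) \<partial>P)"
    using finp assms by (simp add: moment_eq_moment_norm_powr)
  also have "\<dots> \<le> (\<integral>\<^sup>+ \<omega>. (ennreal ((l * a) powr p) + ennreal ((K * a) powr p) * indicator A \<omega>)
                   + ennreal ((K * a) powr (p - q)) * ennreal (\<bar>W \<omega>\<bar> powr q) \<partial>P)"
  proof (rule nn_integral_mono)
    fix \<omega> assume \<omega>: "\<omega> \<in> space P"
    have "ennreal (\<bar>W \<omega>\<bar> powr p) \<le> ennreal ((l * a) powr p + (K * a) powr p * indicator A \<omega> + (K * a) powr (p - q) * \<bar>W \<omega>\<bar> powr q)"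
      using ptw[OF \<omega>] nonneg[OF \<omega>] by (intro ennreal_leI) simp
    also have "\<dots> = (ennreal ((l * a) powr p) + ennreal ((K * a) powr p) * indicator A \<omega>)
                   + ennreal ((K * a) powr (p - q)) * ennreal (\<bar>W \<omega>\<bar> powr q)"
      by (simp add: ennreal_mult' ennreal_indicator)
    finally show "ennreal (\<bar>W \<omega>\<bar> powr p) \<le> \<dots>" .
  qed
  also have "\<dots> = ennreal ((l * a) powr p) + ennreal ((K * a) powr p) * ennreal (prob A)
       + ennreal ((K * a) powr (p - q)) * (\<integral>\<^sup>+ \<omega>. ennreal (\<bar>W \<omega>\<bar> powr q) \<partial>P)"
    by (simp add: nn_integral_add nn_integral_cmult nn_integral_cmult_indicator emeasure_eq_measure prob_space)
  also have "(\<integral>\<^sup>+ \<omega>. ennreal (\<bar>W \<omega>\<bar> powr q) \<partial>P) = ennreal (b powr q)"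
    using assms by (simp add: moment_eq_moment_norm_powr b_def)
  also have "ennreal ((l * a) powr p) + ennreal ((K * a) powr p) * ennreal (prob A)
       + ennreal ((K * a) powr (p - q)) * ennreal (b powr q)
      = ennreal ((l * a) powr p + (K * a) powr p * prob A + (K * a) powr (p - q) * b powr q)"
    by (simp add: ennreal_mult')
  finally have main: "a powr p \<le> (l * a) powr p + (K * a) powr p * prob A + (K * a) powr (p - q) * b powr q"
    by (subst (asm) ennreal_le_iff) auto
  have "(K * a) powr (p - q) * b powr q \<le> (K * a) powr (p - q) * (C * a) powr q"
    using b b0 assms by (intro mult_left_mono powr_mono2) auto
  also have "\<dots> = (K powr (p - q) * C powr q) * a powr p"
    using K a assms by (simp add: powr_mult powr_diff field_simps)
  also have "\<dots> \<le> 1/4 * a powr p"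
  proof (rule mult_right_mono)
    have "4 * C powr q = ((4 * C powr q) powr (1 / (q - p))) powr (q - p)"
      using assms by (simp add: powr_powr)
    also have "\<dots> \<le> K powr (q - p)"
      using assms by (intro powr_mono2) (auto simp: K_def pz_trunc_def)
    finally show "K powr (p - q) * C powr q \<le> 1/4"
      using K by (simp add: powr_diff field_simps)
  qed simp
  finally have "a powr p \<le> 1/4 * a powr p + K powr p * prob A * a powr p + 1/4 * a powr p"
    using main l a K assms by (simp add: powr_mult mult_ac)
  then have "(1/2) * a powr p \<le> (K powr p * prob A) * a powr p" by simp
  then have "1/2 \<le> K powr p * prob A" using a by simp
  then show ?thesis using K by (simp add: pz_prob_def field_simps A_def flip: K_def l_def)
qed

section \<open>Minima and maxima of independent copies\<close>

lemma prob_space_iid_space: "prob_space M \<Longrightarrow> prob_space (iid_space M n)"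
  unfolding iid_space_def by (rule prob_space_PiM)

lemma measurable_iid_component:
  "i < n \<Longrightarrow> (\<lambda>\<omega>. \<omega> i) \<in> measurable (iid_space M n) M"
  unfolding iid_space_def by (rule measurable_component_singleton) simp

lemma measurable_iid_min [measurable]:
  assumes [measurable]: "W \<in> borel_measurable M" shows "iid_min n W \<in> borel_measurable (iid_space M n)"
  unfolding iid_min_def iid_space_def by (intro borel_measurable_Min) auto

lemma measurable_iid_max [measurable]:
  assumes [measurable]: "W \<in> borel_measurable M" shows "iid_max n W \<in> borel_measurable (iid_space M n)"
  unfolding iid_max_def iid_space_def by (intro borel_measurable_Max) auto

lemma iid_min_in_range:
  assumes "n \<ge> 1"
  shows "\<exists>i<n. iid_min n W \<omega> = W (\<omega> i)"
proof -
  have "iid_min n W \<omega> \<in> (\<lambda>i. W (\<omega> i)) ` {..<n}"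
    unfolding iid_min_def using assms by (intro Min_in) (auto simp: lessThan_empty_iff)
  then show ?thesis by auto
qed

lemma iid_max_in_range:
  assumes "n \<ge> 1"
  shows "\<exists>i<n. iid_max n W \<omega> = W (\<omega> i)"
proof -
  have "iid_max n W \<omega> \<in> (\<lambda>i. W (\<omega> i)) ` {..<n}"
    unfolding iid_max_def using assms by (intro Max_in) (auto simp: lessThan_empty_iff)
  then show ?thesis by auto
qed

lemma space_iid_spaceD: "\<omega> \<in> space (iid_space M n) \<Longrightarrow> i < n \<Longrightarrow> \<omega> i \<in> space M"
  by (auto simp: iid_space_def space_PiM)

lemma nonneg_rv_iid_min:
  assumes "nonneg_rv M W" "n \<ge> 1"
  shows "nonneg_rv (iid_space M n) (iid_min n W)"
  unfolding nonneg_rv_def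
proof (intro conjI ballI)
  show "iid_min n W \<in> borel_measurable (iid_space M n)"
    using assms by (intro measurable_iid_min) (simp add: nonneg_rv_def)
  fix \<omega> assume "\<omega> \<in> space (iid_space M n)"
  then show "0 \<le> iid_min n W \<omega>"
    using iid_min_in_range[OF assms(2), of W \<omega>] assms(1) space_iid_spaceD[of \<omega> M n]
    by (auto simp: nonneg_rv_def)
qed

lemma nonneg_rv_iid_max:
  assumes "nonneg_rv M W" "n \<ge> 1"
  shows "nonneg_rv (iid_space M n) (iid_max n W)"
  unfolding nonneg_rv_def
proof (intro conjI ballI)
  show "iid_max n W \<in> borel_measurable (iid_space M n)"
    using assms by (intro measurable_iid_max) (simp add: nonneg_rv_def)
  fix \<omega> assume "\<omega> \<in> space (iid_space M n)"
  then show "0 \<le> iid_max n W \<omega>"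
    using iid_max_in_range[OF assms(2), of W \<omega>] assms(1) space_iid_spaceD[of \<omega> M n]
    by (auto simp: nonneg_rv_def)
qed

lemma measure_iid_space_all:
  assumes "prob_space M" and meas: "{x\<in>space M. R x} \<in> sets M"
  shows "measure (iid_space M n) {\<omega>\<in>space (iid_space M n). \<forall>i<n. R (\<omega> i)}
       = measure M {x\<in>space M. R x} ^ n"
proof -
  interpret prob_space M by fact
  interpret finite_product_prob_space "\<lambda>_::nat. M" "{..<n}" by unfold_locales auto
  have "{\<omega>\<in>space (iid_space M n). \<forall>i<n. R (\<omega> i)} = (\<Pi>\<^sub>E i\<in>{..<n}. {x\<in>space M. R x})"
  proof (rule set_eqI)
    fix \<omega>
    show "\<omega> \<in> {\<omega>\<in>space (iid_space M n). \<forall>i<n. R (\<omega> i)} \<longleftrightarrow> \<omega> \<in> (\<Pi>\<^sub>E i\<in>{..<n}. {x\<in>space M. R x})"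
      unfolding iid_space_def space_PiM mem_Collect_eq PiE_iff Ball_def lessThan_iff by metis
  qed
  then show ?thesis
    using finite_measure_PiM_emb[of "\<lambda>_. {x\<in>space M. R x}"] meas by (simp add: iid_space_def)
qed

lemma iid_min_tail:
  assumes "prob_space M" and [measurable]: "W \<in> borel_measurable M" and "n \<ge> 1"
  shows "measure (iid_space M n) {\<omega>\<in>space (iid_space M n). t < iid_min n W \<omega>}
       = measure M {\<omega>\<in>space M. t < W \<omega>} ^ n"
proof -
  have iff: "t < iid_min n W \<omega> \<longleftrightarrow> (\<forall>i<n. t < W (\<omega> i))" for \<omega>
    unfolding iid_min_def using assms(3) by (subst Min_gr_iff) (auto simp: lessThan_empty_iff)
  show ?thesis
    unfolding iff by (rule measure_iid_space_all[OF assms(1)]) measurable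
qed

lemma iid_max_tail:
  assumes "prob_space M" and W [measurable]: "W \<in> borel_measurable M" and "n \<ge> 1"
  shows "measure (iid_space M n) {\<omega>\<in>space (iid_space M n). t < iid_max n W \<omega>}
       = 1 - (1 - measure M {\<omega>\<in>space M. t < W \<omega>}) ^ n"
proof -
  interpret M: prob_space M by fact
  interpret I: prob_space "iid_space M n" by (rule prob_space_iid_space) fact
  note measurable_iid_max[OF W, of n, measurable]
  have iff: "\<not> t < iid_max n W \<omega> \<longleftrightarrow> (\<forall>i<n. \<not> t < W (\<omega> i))" for \<omega>
    unfolding iid_max_def not_less using assms(3) by (subst Max_le_iff) (auto simp: lessThan_empty_iff)
  have "I.prob {\<omega>\<in>space (iid_space M n). \<not> t < iid_max n W \<omega>} = M.prob {\<omega>\<in>space M. \<not> t < W \<omega>} ^ n"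
    unfolding iff by (rule measure_iid_space_all[OF assms(1)]) measurable
  moreover have "I.prob {\<omega>\<in>space (iid_space M n). \<not> t < iid_max n W \<omega>}
      = 1 - I.prob {\<omega>\<in>space (iid_space M n). t < iid_max n W \<omega>}"
    by (rule I.prob_neg) measurable
  moreover have "M.prob {\<omega>\<in>space M. \<not> t < W \<omega>} = 1 - M.prob {\<omega>\<in>space M. t < W \<omega>}"
    by (rule M.prob_neg) measurable
  ultimately show ?thesis by simp
qed

text \<open>Any variable that picks one of the values \<open>W (\<omega> i)\<close>, the minimum and the maximum in particular,
has its \<open>q\<close>-th power dominated by the sum of the \<open>q\<close>-th powers of all of them.\<close>
lemma moment_norm_iid_lt_top:
  assumes "prob_space M" and [measurable]: "W \<in> borel_measurable M"
    and fin: "moment_norm M q W < \<infinity>" and sel: "\<And>\<omega>. \<exists>i<n. V \<omega> = W (\<omega> i)"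
  shows "moment_norm (iid_space M n) q V < \<infinity>"
proof -
  have comp: "(\<integral>\<^sup>+ \<omega>. ennreal (\<bar>W (\<omega> i)\<bar> powr q) \<partial>iid_space M n) = (\<integral>\<^sup>+ x. ennreal (\<bar>W x\<bar> powr q) \<partial>M)"
    if "i < n" for i
  proof -
    have "distr (iid_space M n) M (\<lambda>\<omega>. \<omega> i) = M"
      using distr_PiM_component[of "{..<n}" "\<lambda>_. M" i] that assms(1) by (simp add: iid_space_def)
    moreover have "(\<integral>\<^sup>+ x. ennreal (\<bar>W x\<bar> powr q) \<partial>distr (iid_space M n) M (\<lambda>\<omega>. \<omega> i))
        = (\<integral>\<^sup>+ \<omega>. ennreal (\<bar>W (\<omega> i)\<bar> powr q) \<partial>iid_space M n)"
      using that by (intro nn_integral_distr measurable_iid_component) auto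
    ultimately show ?thesis by simp
  qed
  have "(\<integral>\<^sup>+ \<omega>. ennreal (\<bar>V \<omega>\<bar> powr q) \<partial>iid_space M n)
      \<le> (\<integral>\<^sup>+ \<omega>. (\<Sum>i<n. ennreal (\<bar>W (\<omega> i)\<bar> powr q)) \<partial>iid_space M n)"
  proof (rule nn_integral_mono)
    fix \<omega>
    obtain i where "i < n" "V \<omega> = W (\<omega> i)" using sel by blast
    then show "ennreal (\<bar>V \<omega>\<bar> powr q) \<le> (\<Sum>i<n. ennreal (\<bar>W (\<omega> i)\<bar> powr q))"
      using member_le_sum[of i "{..<n}" "\<lambda>i. ennreal (\<bar>W (\<omega> i)\<bar> powr q)"] by simp
  qed
  also have "\<dots> = (\<Sum>i<n. \<integral>\<^sup>+ \<omega>. ennreal (\<bar>W (\<omega> i)\<bar> powr q) \<partial>iid_space M n)"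
    by (rule nn_integral_sum) (auto intro!: measurable_compose[OF measurable_iid_component])
  also have "\<dots> = (\<Sum>i<n. \<integral>\<^sup>+ x. ennreal (\<bar>W x\<bar> powr q) \<partial>M)"
    using comp by simp
  also have "\<dots> < \<infinity>"
    using fin by (simp add: moment_norm_lt_top_iff ennreal_mult_less_top of_nat_less_top)
  finally show ?thesis by (simp add: moment_norm_lt_top_iff)
qed

text \<open>Applied to minima and maxima, this shows that their \<open>p\<close>-norms are positive, as the tail bounds
require of their scales, unless the variable vanishes almost surely.\<close>
lemma moment_norm_pos_iff:
  assumes "prob_space P" and rv: "nonneg_rv P W" and "0 < r" and fin: "moment_norm P r W < \<infinity>"
  shows "0 < enn2real (moment_norm P r W) \<longleftrightarrow> 0 < measure P {\<omega>\<in>space P. 0 < W \<omega>}"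
proof -
  interpret prob_space P by fact
  have [measurable]: "W \<in> borel_measurable P" and nonneg: "\<And>\<omega>. \<omega> \<in> space P \<Longrightarrow> 0 \<le> W \<omega>"
    using rv by (auto simp: nonneg_rv_def)
  have "enn2real (moment_norm P r W) = 0 \<longleftrightarrow> (\<integral>\<^sup>+ \<omega>. ennreal (\<bar>W \<omega>\<bar> powr r) \<partial>P) = 0"
    using moment_eq_moment_norm_powr[OF \<open>0 < r\<close> fin] by simp
  also have "\<dots> \<longleftrightarrow> (AE \<omega> in P. ennreal (\<bar>W \<omega>\<bar> powr r) = 0)"
    by (rule nn_integral_0_iff_AE) simp
  also have "\<dots> \<longleftrightarrow> (AE \<omega> in P. \<not> 0 < W \<omega>)"
    by (intro AE_cong) (use nonneg in force)
  also have "\<dots> \<longleftrightarrow> prob {\<omega>\<in>space P. 0 < W \<omega>} = 0"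
    by (subst prob_eq_0) auto
  finally show ?thesis
    using enn2real_nonneg[of "moment_norm P r W"] measure_nonneg[of P "{\<omega>\<in>space P. 0 < W \<omega>}"]
    by linarith
qed

section \<open>Tails on a common scale\<close>

text \<open>Markov's inequality, with the \<open>q\<close>-norm of the dominated variable \<open>V\<close> replaced by the \<open>p\<close>-norm
\<open>a\<close> of the dominating hypercontractive one. Thus \<open>a\<close> is a common scale for the tails of \<open>U\<close> and \<open>V\<close>.\<close>
lemma dominated_tail_upper:
  fixes P :: "'c measure" and U :: "'c \<Rightarrow> real" and Q :: "'d measure" and V :: "'d \<Rightarrow> real"
  assumes "prob_space Q" and "V \<in> borel_measurable Q" and "0 < q" "0 \<le> B" "0 \<le> C" "0 < s"
    and dom: "moment_norm Q q V \<le> ennreal B * moment_norm P q U"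
    and hyper: "moment_norm P q U \<le> ennreal C * moment_norm P p U"
    and fin: "moment_norm P p U < \<infinity>"
    and a: "a = enn2real (moment_norm P p U)" "0 < a"
  shows "measure Q {\<omega>\<in>space Q. s * a < V \<omega>} \<le> (B * C / s) powr q"
proof -
  have "moment_norm Q q V \<le> ennreal B * (ennreal C * moment_norm P p U)"
    using dom mult_left_mono[OF hyper] by (rule order_trans) simp
  also have "\<dots> = ennreal (B * C * a)"
    using assms by (simp add: ennreal_mult less_top mult_ac)
  finally have "measure Q {\<omega>\<in>space Q. s * a < V \<omega>} \<le> (B * C * a / (s * a)) powr q"
    using assms by (intro moment_norm_tail_bound) auto
  then show ?thesis using a by simp
qed

text \<open>The multiple of the common scale at which the bound \<open>(B * C / s) powr q\<close> is at most half the square of the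
lower tail probability \<open>pz_prob p q C\<close>. The maximum with \<open>1\<close> keeps the scale positive when \<open>B * C = 0\<close>.\<close>
definition dom_scale :: "real \<Rightarrow> real \<Rightarrow> real \<Rightarrow> real \<Rightarrow> real" where
  "dom_scale p q B C = max 1 (B * C * (2 / (pz_prob p q C)\<^sup>2) powr (1 / q))"

lemma dom_scale_pos: "0 < dom_scale p q B C"
  by (simp add: dom_scale_def less_max_iff_disj)

lemma comparable_tails:
  fixes P :: "'c measure" and U :: "'c \<Rightarrow> real" and Q :: "'d measure" and V :: "'d \<Rightarrow> real"
  assumes "prob_space P" "prob_space Q" and "nonneg_rv P U" "nonneg_rv Q V"
    and pq: "0 < p" "p < q" and "0 \<le> B" "0 \<le> C"
    and fin: "moment_norm P q U < \<infinity>"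
    and hyper: "moment_norm P q U \<le> ennreal C * moment_norm P p U"
    and dom: "moment_norm Q q V \<le> ennreal B * moment_norm P q U"
    and a: "a = enn2real (moment_norm P p U)" "0 < a"
  shows "pz_prob p q C \<le> measure P {\<omega>\<in>space P. pz_level p * a < U \<omega>}"
    and "measure Q {\<omega>\<in>space Q. dom_scale p q B C * a < V \<omega>} \<le> (pz_prob p q C)\<^sup>2 / 2"
proof -
  show "pz_prob p q C \<le> measure P {\<omega>\<in>space P. pz_level p * a < U \<omega>}"
    by (rule hypercontractive_tail_lower) fact+
  define c where "c = pz_prob p q C"
  define s where "s = dom_scale p q B C"
  have c: "0 < c" using pz_prob_bounds pq by (simp add: c_def)
  have s: "0 < s" using dom_scale_pos by (simp add: s_def)
  have finp: "moment_norm P p U < \<infinity>"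
    using assms by (intro moment_norm_lt_top_mono[OF _ _ pq fin]) (auto simp: nonneg_rv_def)
  have "measure Q {\<omega>\<in>space Q. s * a < V \<omega>} \<le> (B * C / s) powr q"
    using assms s finp by (intro dominated_tail_upper[OF _ _ _ _ _ _ dom hyper]) (auto simp: nonneg_rv_def)
  also have "\<dots> \<le> c\<^sup>2 / 2"
  proof -
    have "B * C = B * C * ((2 / c\<^sup>2) powr (1 / q) * (c\<^sup>2 / 2) powr (1 / q))"
      using c by (simp flip: powr_mult)
    also have "\<dots> = (B * C * (2 / c\<^sup>2) powr (1 / q)) * (c\<^sup>2 / 2) powr (1 / q)" by simp
    also have "\<dots> \<le> s * (c\<^sup>2 / 2) powr (1 / q)"
      by (intro mult_right_mono) (simp_all add: s_def dom_scale_def c_def)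
    finally have "B * C / s \<le> (c\<^sup>2 / 2) powr (1 / q)" using s by (simp add: field_simps)
    then have "(B * C / s) powr q \<le> ((c\<^sup>2 / 2) powr (1 / q)) powr q"
      using assms s by (intro powr_mono2) auto
    then show ?thesis using assms c by (simp add: powr_powr)
  qed
  finally show "measure Q {\<omega>\<in>space Q. dom_scale p q B C * a < V \<omega>} \<le> (pz_prob p q C)\<^sup>2 / 2"
    by (simp add: s_def c_def)
qed

section \<open>Comparison of the distribution functions\<close>

lemma antimono_tail:
  fixes W :: "'a \<Rightarrow> real"
  assumes "prob_space M" and [measurable]: "W \<in> borel_measurable M"
  shows "antimono (\<lambda>t. measure M {\<omega>\<in>space M. t < W \<omega>})"
proof -
  interpret prob_space M by fact
  show ?thesis by (intro antimonoI finite_measure_mono) auto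
qed

theorem theorem5p4:
  fixes M :: "'a measure" and N :: "'b measure"
    and X :: "'a \<Rightarrow> real" and Y :: "'b \<Rightarrow> real"
    and p q :: real
  assumes "prob_space M" and "prob_space N"
    and "0 < p" and "p < q"
    and "nonneg_rv M X" and "nonneg_rv N Y"
    and "min_hypercontractive M p q X" and "max_hypercontractive M p q X"
    and "\<exists>B\<ge>0. \<forall>n\<ge>1. min_norm N q n Y \<le> ennreal B * min_norm M q n X
                   \<and> max_norm N q n Y \<le> ennreal B * max_norm M q n X"
  shows "\<exists>D>0. \<forall>t\<ge>0. measure N {\<omega>\<in>space N. Y \<omega> \<le> t}
                    \<ge> measure M {\<omega>\<in>space M. D * X \<omega> \<le> t}"
proof -
  interpret M: prob_space M by fact
  interpret N: prob_space N by fact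
  note rvX = \<open>nonneg_rv M X\<close> and rvY = \<open>nonneg_rv N Y\<close>
  have meas [measurable]: "X \<in> borel_measurable M" "Y \<in> borel_measurable N"
    using rvX rvY by (auto simp: nonneg_rv_def)
  have q: "0 < q" using assms(3,4) by simp
  obtain B where B: "B \<ge> 0"
    and dom_min: "\<And>n. n \<ge> 1 \<Longrightarrow> min_norm N q n Y \<le> ennreal B * min_norm M q n X"
    and dom_max: "\<And>n. n \<ge> 1 \<Longrightarrow> max_norm N q n Y \<le> ennreal B * max_norm M q n X"
    using assms(9) by blast
  obtain C1 where C1: "C1 \<ge> 0" "\<And>n. n \<ge> 1 \<Longrightarrow> min_norm M q n X \<le> ennreal C1 * min_norm M p n X"
    using assms(7) by (auto simp: min_hypercontractive_def)
  obtain C2 where C2: "C2 \<ge> 0" "\<And>n. n \<ge> 1 \<Longrightarrow> max_norm M q n X \<le> ennreal C2 * max_norm M p n X"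
    using assms(8) by (auto simp: max_hypercontractive_def)
  define C where "C = max C1 C2"
  have C: "C \<ge> 0" using C1 by (simp add: C_def)
  have hyp_min: "min_norm M q n X \<le> ennreal C * min_norm M p n X" if "n \<ge> 1" for n
    using C1(2)[OF that] by (rule order_trans) (intro mult_right_mono ennreal_leI, auto simp: C_def)
  have hyp_max: "max_norm M q n X \<le> ennreal C * max_norm M p n X" if "n \<ge> 1" for n
    using C2(2)[OF that] by (rule order_trans) (intro mult_right_mono ennreal_leI, auto simp: C_def)
  have "(\<integral>\<^sup>+ \<omega>. ennreal (\<bar>X \<omega>\<bar> powr q) \<partial>M) = (\<integral>\<^sup>+ \<omega>. ennreal (X \<omega> powr q) \<partial>M)"
    using rvX by (intro nn_integral_cong) (simp add: nonneg_rv_def)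
  then have finX: "moment_norm M q X < \<infinity>"
    using assms(7) by (simp add: min_hypercontractive_def moment_norm_lt_top_iff)
  have finX': "moment_norm M p X < \<infinity>"
    by (rule moment_norm_lt_top_mono[OF _ _ assms(3,4) finX]) (simp_all add: assms(1))
  have fin_min: "min_norm M r n X < \<infinity>" if "n \<ge> 1" "moment_norm M r X < \<infinity>" for n r
    using that by (intro moment_norm_iid_lt_top[OF assms(1) _ _ iid_min_in_range]) simp_all
  have fin_max: "max_norm M r n X < \<infinity>" if "n \<ge> 1" "moment_norm M r X < \<infinity>" for n r
    using that by (intro moment_norm_iid_lt_top[OF assms(1) _ _ iid_max_in_range]) simp_all
  note finq_min = fin_min[OF _ finX] and finq_max = fin_max[OF _ finX]
  define F where "F = (\<lambda>t. measure M {\<omega>\<in>space M. t < X \<omega>})"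
  define G where "G = (\<lambda>t. measure N {\<omega>\<in>space N. t < Y \<omega>})"
  have F: "antimono F" "\<And>t. 0 \<le> F t" "\<And>t. F t \<le> 1"
    and G: "antimono G" "\<And>t. 0 \<le> G t" "\<And>t. G t \<le> 1"
    using antimono_tail[OF assms(1) meas(1)] antimono_tail[OF assms(2) meas(2)]
    by (auto simp: F_def G_def)
  have "\<exists>D>0. \<forall>t\<ge>0. G t \<le> F (t / D)"
  proof (cases "F 0 = 0")
    case True
    \<comment> \<open>Here \<open>X = 0\<close> almost surely, and domination for samples of size one forces \<open>Y = 0\<close> almost surely.\<close>
    have "\<not> 0 < enn2real (min_norm M q 1 X)"
      using moment_norm_pos_iff[OF prob_space_iid_space[OF assms(1)] nonneg_rv_iid_min[OF rvX order_refl] q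
          finq_min[OF order_refl]] iid_min_tail[OF assms(1) _ order_refl, of X 0] True
      by (simp add: F_def)
    then have "min_norm M q 1 X = 0"
      using finq_min[of 1] by (simp add: enn2real_positive_iff zero_less_iff_neq_zero)
    then have zero: "min_norm N q 1 Y = 0" using dom_min[of 1] by simp
    have "\<not> 0 < measure (iid_space N 1) {\<omega>\<in>space (iid_space N 1). 0 < iid_min 1 Y \<omega>}"
      using zero rvY q moment_norm_pos_iff[of "iid_space N 1" "iid_min 1 Y" q]
      by (simp add: prob_space_iid_space assms(2) nonneg_rv_iid_min)
    then have "\<not> 0 < G 0" using iid_min_tail[OF assms(2) meas(2) order_refl, of 0] by (simp add: G_def)
    then have "G 0 = 0" using G(2)[of 0] by simp
    then have "G t \<le> F (t / 1)" if "t \<ge> 0" for t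
      using antimonoD[OF G(1) that] F(2)[of t] by simp
    then show ?thesis by (intro exI[of _ 1]) auto
  next
    case False
    then have F0: "0 < F 0" using F(2)[of 0] by simp
    define a where "a = (\<lambda>n. enn2real (min_norm M p n X))"
    define b where "b = (\<lambda>n. enn2real (max_norm M p n X))"
    define c where "c = pz_prob p q C"
    define l where "l = pz_level p"
    define s where "s = dom_scale p q B C"
    note iid = prob_space_iid_space[OF assms(1)] prob_space_iid_space[OF assms(2)]
    have a: "0 < a n" if n: "n \<ge> 1" for n
      using moment_norm_pos_iff[OF iid(1) nonneg_rv_iid_min[OF rvX n] assms(3) fin_min[OF n finX']]
        iid_min_tail[OF assms(1) _ n, of X 0] F0
      by (simp add: a_def F_def)
    have b: "0 < b n" if n: "n \<ge> 1" for n
    proof -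
      have "(1 - F 0) ^ n \<le> (1 - F 0) ^ 1"
        using F0 F(3)[of 0] n by (intro power_decreasing) auto
      then have "(1 - F 0) ^ n < 1" using F0 by simp
      then show ?thesis
        using moment_norm_pos_iff[OF iid(1) nonneg_rv_iid_max[OF rvX n] assms(3) fin_max[OF n finX']]
          iid_max_tail[OF assms(1) _ n, of X 0]
        by (simp add: b_def F_def)
    qed
    \<comment> \<open>The two grids meet at sample size one, which leaves no gap between the range of \<open>t\<close> covered
      by the minima and the one covered by the maxima.\<close>
    have "iid_min 1 X = iid_max 1 X"
      by (simp add: fun_eq_iff iid_min_def iid_max_def lessThan_Suc)
    then have start: "a 1 = b 1" by (simp add: a_def b_def)
    have minF: "c \<le> F (l * a n) ^ n" and minG: "G (s * a n) ^ n \<le> c\<^sup>2 / 2" if n: "n \<ge> 1" for n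
      using comparable_tails[OF iid nonneg_rv_iid_min[OF rvX n] nonneg_rv_iid_min[OF rvY n] assms(3,4) B C
          finq_min[OF n] hyp_min[OF n] dom_min[OF n] refl a[OF n, unfolded a_def]]
      by (simp_all add: iid_min_tail[OF assms(1) _ n] iid_min_tail[OF assms(2) _ n] a_def l_def c_def s_def F_def G_def)
    have maxF: "c \<le> 1 - (1 - F (l * b n)) ^ n" and maxG: "1 - (1 - G (s * b n)) ^ n \<le> c\<^sup>2 / 2" if n: "n \<ge> 1" for n
      using comparable_tails[OF iid nonneg_rv_iid_max[OF rvX n] nonneg_rv_iid_max[OF rvY n] assms(3,4) B C
          finq_max[OF n] hyp_max[OF n] dom_max[OF n] refl b[OF n, unfolded b_def]]
      by (simp_all add: iid_max_tail[OF assms(1) _ n] iid_max_tail[OF assms(2) _ n] b_def l_def c_def s_def F_def G_def)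
    have l: "0 < l" by (simp add: l_def pz_level_def)
    have s: "0 < s" by (simp add: s_def dom_scale_pos)
    have c: "0 < c" "c \<le> 1/2" using pz_prob_bounds assms(3) by (auto simp: c_def)
    have "G t \<le> F (t / (s / l))" for t
      using tail_comparison_of_sequences[OF F G c l s start minF minG maxF maxG, of t]
      by (simp add: mult.commute)
    then show ?thesis using l s by (intro exI[of _ "s / l"]) auto
  qed
  then obtain D where D: "D > 0" and le: "\<And>t. t \<ge> 0 \<Longrightarrow> G t \<le> F (t / D)" by blast
  have "measure M {\<omega>\<in>space M. D * X \<omega> \<le> t} \<le> measure N {\<omega>\<in>space N. Y \<omega> \<le> t}" if "t \<ge> 0" for t
  proof -
    have "measure M {\<omega>\<in>space M. D * X \<omega> \<le> t} = measure M {\<omega>\<in>space M. \<not> t / D < X \<omega>}"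
      using D by (intro arg_cong[where f = "measure M"]) (auto simp: field_simps not_less)
    also have "\<dots> = 1 - F (t / D)" by (subst M.prob_neg) (auto simp: F_def)
    also have "\<dots> \<le> 1 - G t" using le[OF that] by simp
    also have "\<dots> = measure N {\<omega>\<in>space N. \<not> t < Y \<omega>}" by (subst N.prob_neg) (auto simp: G_def)
    finally show ?thesis by (simp add: not_less)
  qed
  with D show ?thesis by blast
qed

end
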